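(* Let $\mathcal G$ be a continuous graph obtained from a finite simple graph all of whose vertices have degree at least $2$, with vertex set $\mathcal V$, edge set $\mathcal E$, and all edges of length $1$. Let $Z_1$ be the complex vector space of functions $f:\mathcal E\to\mathbb C$ such that $$\sum_{e \text{ incident on } v} f(e)=0\quad\text{for every } v\in\mathcal V .$$ Let $n\ge 1$ be an integer. Then the linear map sending $f\in Z_1$ to the function $g$ on $\mathcal G$ given on each edge $e\cong[0,1]$ by $$g_e(x)=f(e)\,\sin((2n-1)\pi x),\qquad 0\le x\le 1,$$ is an isomorphism from $Z_1$ onto $E_0((2n-1)^2\pi^2)$. Moreover, $Z_1$ has an integral basis, i.e. a basis consisting of functions $f:\mathcal E\to\mathbb Z$.
   Context: Continuous graph: each edge $e$ of the finite simple graph is identified with the interval $[0,1]$ (with an arbitrarily chosen orientation), the endpoints $0$ and $1$ being identified with the two end vertices of $e$. $L^2(\mathcal G)=\bigoplus_{e\in\mathcal E}L^2[0,1]$ (complex valued functions $f=(f_e)_e$). Standard vertex conditions: (i) continuity: for each vertex $v$, the functions $f_e$ on all edges $e$ incident on $v$ have the same value at $v$; (ii) derivative condition: for each vertex $v$, $\sum_{e\sim v}\partial_\nu f_e(v)=0$, the sum being over edges incident on $v$, where $\partial_\nu f_e(v)=f_e'(0)$ if $v$ is identified with the endpoint $0$ of $e$ and $\partial_\nu f_e(v)=-f_e'(1)$ if $v$ is identified with the endpoint $1$. The operator $\Delta_\infty$ acts by $\Delta_\infty f=-f''$ on the domain of all $f\in L^2(\mathcal G)$ with $f_e'$ absolutely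 continuous on each edge, $f''\in L^2(\mathcal G)$, and satisfying the standard vertex conditions. It is self adjoint with compact resolvent. $E(\lambda)$ denotes the eigenspace of $\Delta_\infty$ for $\lambda$, and for an integer $k\ge1$, $E_0(k^2\pi^2)\subset E(k^2\pi^2)$ denotes the subspace of those eigenfunctions (together with $0$) vanishing at all vertices of $\mathcal G$. *)

theory Defs
  imports "HOL-Analysis.Analysis" "HOL-Library.Function_Algebras"
begin

section \<open>Vector spaces of functions\<close>

definition edge_scale :: "complex \<Rightarrow> ('e \<Rightarrow> complex) \<Rightarrow> 'e \<Rightarrow> complex" where
  "edge_scale c f = (\<lambda>e. c * f e)"

definition graph_scale :: "complex \<Rightarrow> ('e \<Rightarrow> real \<Rightarrow> complex) \<Rightarrow> 'e \<Rightarrow> real \<Rightarrow> complex" where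
  "graph_scale c g = (\<lambda>e x. c * g e x)"

global_interpretation edge_fun: vector_space "edge_scale :: complex \<Rightarrow> ('e \<Rightarrow> complex) \<Rightarrow> _"
  by unfold_locales (auto simp: edge_scale_def plus_fun_def algebra_simps)

global_interpretation graph_fun: vector_space
    "graph_scale :: complex \<Rightarrow> ('e \<Rightarrow> real \<Rightarrow> complex) \<Rightarrow> _"
  by unfold_locales (auto simp: graph_scale_def plus_fun_def algebra_simps)

section \<open>Graphs\<close>

definition simple_graph :: "'v set \<Rightarrow> 'v set set \<Rightarrow> bool" where
  "simple_graph V E \<longleftrightarrow> finite V \<and> (\<forall>e\<in>E. e \<subseteq> V \<and> card e = 2)"

definition incident_edges :: "'v set set \<Rightarrow> 'v \<Rightarrow> 'v set set" where
  "incident_edges E v = {e \<in> E. v \<in> e}"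

definition vertex_degree :: "'v set set \<Rightarrow> 'v \<Rightarrow> nat" where
  "vertex_degree E v = card (incident_edges E v)"

text \<open>An orientation is given by the vertex \<open>org e\<close> of \<open>e\<close> which is identified with the
  endpoint \<open>0\<close>; the other vertex of \<open>e\<close> is then identified with \<open>1\<close>.\<close>

definition orientation :: "'v set set \<Rightarrow> ('v set \<Rightarrow> 'v) \<Rightarrow> bool" where
  "orientation E org \<longleftrightarrow> (\<forall>e\<in>E. org e \<in> e)"

text \<open>Functions on the edge set are extended by zero to all of \<open>'v set\<close>.\<close>

definition Z1 :: "'v set \<Rightarrow> 'v set set \<Rightarrow> ('v set \<Rightarrow> complex) set" where
  "Z1 V E = {f. (\<forall>e. e \<notin> E \<longrightarrow> f e = 0) \<and> (\<forall>v\<in>V. (\<Sum>e\<in>incident_edges E v. f e) = 0)}"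

section \<open>Analysis on the unit interval\<close>

definition abs_continuous_on_interval :: "real \<Rightarrow> real \<Rightarrow> (real \<Rightarrow> complex) \<Rightarrow> bool" where
  "abs_continuous_on_interval a b h \<longleftrightarrow>
    (\<forall>\<epsilon>>0. \<exists>\<delta>>0. \<forall>P :: (real \<times> real) set.
       finite P \<and> (\<forall>(s, t)\<in>P. a \<le> s \<and> s < t \<and> t \<le> b) \<and>
       pairwise (\<lambda>p q. disjnt {fst p<..<snd p} {fst q<..<snd q}) P \<and>
       (\<Sum>(s, t)\<in>P. t - s) < \<delta>
       \<longrightarrow> (\<Sum>(s, t)\<in>P. cmod (h t - h s)) < \<epsilon>)"

definition square_integrable :: "(real \<Rightarrow> complex) \<Rightarrow> bool" where
  "square_integrable h \<longleftrightarrow>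
    h \<in> borel_measurable (lebesgue_on {0..1}) \<and>
    integrable (lebesgue_on {0..1}) (\<lambda>x. (cmod (h x))\<^sup>2)"

section \<open>Functions on the continuous graph and the operator \<open>\<Delta>\<^sub>\<infinity>\<close>\<close>

text \<open>A function on the continuous graph is a family \<open>g e x\<close> with \<open>e \<in> E\<close> and \<open>0 \<le> x \<le> 1\<close>,
  extended by zero.  Only classes in \<open>L\<^sup>2\<close> with a continuously differentiable representative
  on each edge matter below, and they are represented by that (unique) representative.\<close>

definition on_graph :: "'v set set \<Rightarrow> ('v set \<Rightarrow> real \<Rightarrow> complex) \<Rightarrow> bool" where
  "on_graph E g \<longleftrightarrow> (\<forall>e x. e \<notin> E \<or> x \<notin> {0..1} \<longrightarrow> g e x = 0)"

definition L2_graph :: "'v set set \<Rightarrow> ('v set \<Rightarrow> real \<Rightarrow> complex) set" where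
  "L2_graph E = {g. on_graph E g \<and> (\<forall>e\<in>E. square_integrable (g e))}"

text \<open>One-sided at the endpoints of the edge.\<close>

definition edge_deriv :: "'v set set \<Rightarrow> ('v set \<Rightarrow> real \<Rightarrow> complex) \<Rightarrow> 'v set \<Rightarrow> real \<Rightarrow> complex" where
  "edge_deriv E g = (\<lambda>e x. if e \<in> E \<and> x \<in> {0..1}
     then vector_derivative (g e) (at x within {0..1}) else 0)"

text \<open>\<open>vertex_value\<close> and \<open>normal_deriv\<close> are used only for vertices \<open>v\<close> of the edge \<open>e\<close>.\<close>

definition vertex_value ::
  "('v set \<Rightarrow> 'v) \<Rightarrow> ('v set \<Rightarrow> real \<Rightarrow> complex) \<Rightarrow> 'v set \<Rightarrow> 'v \<Rightarrow> complex" where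
  "vertex_value org g e v = (if v = org e then g e 0 else g e 1)"

definition normal_deriv ::
  "'v set set \<Rightarrow> ('v set \<Rightarrow> 'v) \<Rightarrow> ('v set \<Rightarrow> real \<Rightarrow> complex) \<Rightarrow> 'v set \<Rightarrow> 'v \<Rightarrow> complex" where
  "normal_deriv E org g e v = (if v = org e then edge_deriv E g e 0 else - edge_deriv E g e 1)"

definition standard_vertex_conditions ::
  "'v set \<Rightarrow> 'v set set \<Rightarrow> ('v set \<Rightarrow> 'v) \<Rightarrow> ('v set \<Rightarrow> real \<Rightarrow> complex) \<Rightarrow> bool" where
  "standard_vertex_conditions V E org g \<longleftrightarrow>
    (\<forall>v\<in>V. \<forall>e\<in>incident_edges E v. \<forall>e'\<in>incident_edges E v.
       vertex_value org g e v = vertex_value org g e' v) \<and>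
    (\<forall>v\<in>V. (\<Sum>e\<in>incident_edges E v. normal_deriv E org g e v) = 0)"

text \<open>By Lebesgue's theorem, absolute continuity of \<open>g\<^sub>e'\<close> already implies that \<open>g\<^sub>e'\<close> is
  differentiable almost everywhere, so the clause saying so is no restriction; it is spelled out
  to make \<open>g\<^sub>e''\<close> meaningful as the almost everywhere derivative of \<open>g\<^sub>e'\<close>.\<close>

definition laplacian_domain ::
  "'v set \<Rightarrow> 'v set set \<Rightarrow> ('v set \<Rightarrow> 'v) \<Rightarrow> ('v set \<Rightarrow> real \<Rightarrow> complex) set" where
  "laplacian_domain V E org = {g. g \<in> L2_graph E \<and>
     (\<forall>e\<in>E. g e differentiable_on {0..1} \<and>
        abs_continuous_on_interval 0 1 (edge_deriv E g e) \<and>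
        (AE x in lebesgue_on {0..1}. edge_deriv E g e differentiable (at x within {0..1}))) \<and>
     edge_deriv E (edge_deriv E g) \<in> L2_graph E \<and>
     standard_vertex_conditions V E org g}"

definition laplacian ::
  "'v set set \<Rightarrow> ('v set \<Rightarrow> real \<Rightarrow> complex) \<Rightarrow> 'v set \<Rightarrow> real \<Rightarrow> complex" where
  "laplacian E g = - edge_deriv E (edge_deriv E g)"

definition eigenspace ::
  "'v set \<Rightarrow> 'v set set \<Rightarrow> ('v set \<Rightarrow> 'v) \<Rightarrow> complex \<Rightarrow> ('v set \<Rightarrow> real \<Rightarrow> complex) set" where
  "eigenspace V E org \<mu> = {g \<in> laplacian_domain V E org.
     \<forall>e\<in>E. AE x in lebesgue_on {0..1}. laplacian E g e x = \<mu> * g e x}"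

definition eigenspace0 ::
  "'v set \<Rightarrow> 'v set set \<Rightarrow> ('v set \<Rightarrow> 'v) \<Rightarrow> complex \<Rightarrow> ('v set \<Rightarrow> real \<Rightarrow> complex) set" where
  "eigenspace0 V E org \<mu> = {g \<in> eigenspace V E org \<mu>.
     \<forall>v\<in>V. \<forall>e\<in>incident_edges E v. vertex_value org g e v = 0}"

definition sine_map ::
  "'v set set \<Rightarrow> nat \<Rightarrow> ('v set \<Rightarrow> complex) \<Rightarrow> 'v set \<Rightarrow> real \<Rightarrow> complex" where
  "sine_map E n f = (\<lambda>e x. if e \<in> E \<and> x \<in> {0..1}
     then f e * complex_of_real (sin ((2 * real n - 1) * pi * x)) else 0)"

end

(*
  An eigenfunction for k^2 (k = (2n-1) pi) that vanishes at the vertices satisfies g'' = -k^2 g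
  almost everywhere on each edge.  Its derivative is absolutely continuous, so the fundamental
  theorem of calculus makes the equation hold everywhere, and g_e = f(e) sin(k x).  As cos k = -1,
  the derivative condition at a vertex v reads k * (sum of f(e) over e incident on v) = 0, which is
  membership in Z_1.

  For the integral basis, impose the vertex equations one at a time.  If a space is spanned by a set
  S of integral vectors and phi is an integral functional with phi(b) nonzero for some b in S, then
  the vectors phi(b) x - phi(x) b with x in S are integral and span the kernel of phi.
*)
theory Submission
  imports Defs
begin

section \<open>Integer spanning sets of solution spaces\<close>

lemma sum_edge_fun: "(\<Sum>i\<in>A. F i) e = (\<Sum>i\<in>A. F i e)" for F :: "'i \<Rightarrow> 'e \<Rightarrow> complex"
  by (induction A rule: infinite_finite_induct) auto

lemma edge_linear_comb:
  assumes "\<And>x y. \<phi> (x + y) = \<phi> x + \<phi> y" and "\<And>c x. \<phi> (edge_scale c x) = c * \<phi> x"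
  shows "Vector_Spaces.linear edge_scale edge_scale
    (\<lambda>x. edge_scale k x - edge_scale (\<phi> x) b :: 'e \<Rightarrow> complex)"
  unfolding Vector_Spaces.linear_iff
  using assms edge_fun.vector_space_axioms
  by (auto simp: edge_scale_def fun_eq_iff algebra_simps)

lemma integer_span_kernel:
  fixes S :: "('e \<Rightarrow> complex) set"
  assumes int: "\<forall>f\<in>S. \<forall>e. f e \<in> \<int>"
    and add: "\<And>x y. \<phi> (x + y) = \<phi> x + \<phi> y"
    and scale: "\<And>c x. \<phi> (edge_scale c x) = c * \<phi> x"
    and \<phi>_int: "\<And>x. \<forall>e. x e \<in> \<int> \<Longrightarrow> \<phi> x \<in> \<int>"
  shows "\<exists>T. (\<forall>f\<in>T. \<forall>e. f e \<in> \<int>) \<and> edge_fun.span T = {f \<in> edge_fun.span S. \<phi> f = 0}"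
proof (cases "\<forall>b\<in>S. \<phi> b = 0")
  \<comment> \<open>If \<open>\<phi>\<close> vanishes on \<open>S\<close>, it vanishes on the span
    and imposes nothing, so \<open>S\<close> itself serves.\<close>
  case True
  interpret \<phi>: Vector_Spaces.linear edge_scale "(*) :: complex \<Rightarrow> complex \<Rightarrow> complex" \<phi>
    unfolding Vector_Spaces.linear_iff using add scale edge_fun.vector_space_axioms
    by (auto simp: vector_space_over_itself.vector_space_axioms)
  have "\<phi> f = 0" if "f \<in> edge_fun.span S" for f
    using \<phi>.eq_0_on_span[of S f] True that by blast
  then show ?thesis using int by blast
next
  case False
  then obtain b where b: "b \<in> S" "\<phi> b \<noteq> 0" by blast
  \<comment> \<open>On the kernel of \<open>\<phi>\<close>, \<open>T\<close> is multiplication by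
    \<open>\<phi> b\<close>, so it maps the span onto the kernel. The division by
    \<open>\<phi> b\<close> takes place only in the span and leaves the integrality of the new
    generators untouched.\<close>
  define T where "T = (\<lambda>x. edge_scale (\<phi> b) x - edge_scale (\<phi> x) b)"
  interpret T: Vector_Spaces.linear edge_scale edge_scale T
    unfolding T_def by (rule edge_linear_comb[OF add scale])
  have diff: "\<phi> (x - y) = \<phi> x - \<phi> y" for x y
    using add[of "x - y" y] by simp
  have "T f e \<in> \<int>" if "f \<in> S" for f e
    using int b(1) that \<phi>_int by (auto simp: T_def edge_scale_def)
  moreover have "T ` edge_fun.span S = {f \<in> edge_fun.span S. \<phi> f = 0}"
  proof (intro equalityI subsetI)
    fix f assume "f \<in> T ` edge_fun.span S"
    then obtain x where x: "x \<in> edge_fun.span S" "f = T x" by blast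
    then show "f \<in> {f \<in> edge_fun.span S. \<phi> f = 0}"
      using b(1) by (auto simp: T_def diff scale intro!: edge_fun.span_diff edge_fun.span_scale
          intro: edge_fun.span_base)
  next
    fix f assume f: "f \<in> {f \<in> edge_fun.span S. \<phi> f = 0}"
    have "f = T (edge_scale (1 / \<phi> b) f)"
    proof -
      have "\<phi> (edge_scale (1 / \<phi> b) f) = 0" using f by (simp add: scale)
      then show ?thesis using b(2) by (auto simp: T_def edge_scale_def fun_eq_iff)
    qed
    then show "f \<in> T ` edge_fun.span S"
      using f edge_fun.span_scale by blast
  qed
  ultimately show ?thesis
    using T.span_image[of S] by (intro exI[of _ "T ` S"]) auto
qed

text \<open>Vertices are added one at a time with \<open>E\<close> kept fixed. Since
  \<open>incident_edges E v\<close> does not depend on \<open>V\<close>, a new vertex adds exactly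
  one equation, and its functional, a sum of coordinates, is integral on integral vectors.\<close>

lemma Z1_integer_span:
  fixes V :: "'v set"
  assumes "finite V" "finite E"
  shows "\<exists>S. (\<forall>f\<in>S. \<forall>e. f e \<in> \<int>) \<and> edge_fun.span S = Z1 V E"
  using assms(1)
proof (induction V)
  case empty
  \<comment> \<open>Without vertices there are no equations, and the unit vectors of the edges span
    all functions supported on \<open>E\<close>.\<close>
  define \<delta> where "\<delta> = (\<lambda>a e :: 'v set. if e = a then 1 else 0 :: complex)"
  have "f \<in> edge_fun.span (\<delta> ` E)" if f: "\<And>e. e \<notin> E \<Longrightarrow> f e = 0" for f
  proof -
    have "f = (\<Sum>a\<in>E. edge_scale (f a) (\<delta> a))"
      using assms(2) f
      by (auto simp: fun_eq_iff sum_edge_fun edge_scale_def \<delta>_def if_distrib cong: if_cong)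
    also have "\<dots> \<in> edge_fun.span (\<delta> ` E)"
      by (intro edge_fun.span_sum edge_fun.span_scale edge_fun.span_base) auto
    finally show ?thesis .
  qed
  moreover have "edge_fun.span (\<delta> ` E) \<subseteq> {f. \<forall>e. e \<notin> E \<longrightarrow> f e = 0}"
    by (rule edge_fun.span_minimal)
      (auto simp: \<delta>_def edge_fun.subspace_def edge_scale_def)
  ultimately have "edge_fun.span (\<delta> ` E) = Z1 {} E"
    by (auto simp: Z1_def)
  then show ?case
    by (intro exI[of _ "\<delta> ` E"]) (auto simp: \<delta>_def)
next
  case (insert v V)
  then obtain S where S: "\<forall>f\<in>S. \<forall>e. f e \<in> \<int>" "edge_fun.span S = Z1 V E" by blast
  have "Z1 (insert v V) E = {f \<in> edge_fun.span S. (\<Sum>e\<in>incident_edges E v. f e) = 0}"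
    unfolding S(2) by (auto simp: Z1_def)
  moreover have "\<exists>T. (\<forall>f\<in>T. \<forall>e. f e \<in> \<int>) \<and>
      edge_fun.span T = {f \<in> edge_fun.span S. (\<Sum>e\<in>incident_edges E v. f e) = 0}"
    by (rule integer_span_kernel[OF S(1)])
      (auto simp: sum.distrib edge_scale_def sum_distrib_left)
  ultimately show ?case by simp
qed

text \<open>Integrality passes to subsets, so an integral spanning set can be thinned to a
  basis.\<close>

lemma Z1_integer_basis:
  assumes "finite V" "finite E"
  shows "\<exists>B. edge_fun.independent B \<and> edge_fun.span B = Z1 V E \<and> (\<forall>f\<in>B. \<forall>e. f e \<in> \<int>)"
proof -
  obtain S where S: "\<forall>f\<in>S. \<forall>e. f e \<in> \<int>" "edge_fun.span S = Z1 V E"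
    using Z1_integer_span[OF assms] by blast
  obtain B where B: "B \<subseteq> S" "edge_fun.independent B" "S \<subseteq> edge_fun.span B"
    using edge_fun.maximal_independent_subset by blast
  have "edge_fun.span B = edge_fun.span S"
    by (metis B(1,3) edge_fun.span_eq edge_fun.span_superset order_trans)
  with S B show ?thesis by blast
qed

section \<open>The fundamental theorem of calculus for absolutely continuous functions\<close>

text \<open>With the gauge integral, the Riemann sums can be estimated directly, and integrability
  of \<open>h'\<close> is a result rather than a prerequisite.\<close>

lemma abs_continuous_has_integral:
  assumes "a \<le> b" and ac: "abs_continuous_on_interval a b h" and "negligible N"
    and deriv: "\<And>x. x \<in> {a..b} - N \<Longrightarrow> (h has_vector_derivative h' x) (at x within {a..b})"
  shows "(h' has_integral (h b - h a)) {a..b}"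
proof -
  \<comment> \<open>Setting the integrand to 0 on \<open>N\<close> reduces the terms tagged there to
    increments of \<open>h\<close>; the null set is changed back at the end.\<close>
  define k where "k = (\<lambda>x. if x \<in> N then 0 else h' x)"
  have "(k has_integral (h b - h a)) {a..b}"
    unfolding has_integral_real
  proof (intro allI impI)
    fix \<epsilon> :: real assume "\<epsilon> > 0"
    \<comment> \<open>Half of \<open>\<epsilon>\<close> is reserved for tags outside
      \<open>N\<close>, whose errors add up to at most \<open>\<eta> * (b - a)\<close>. The
      \<open>+ 1\<close> keeps the denominator positive when \<open>a = b\<close>.\<close>
    define \<eta> where "\<eta> = \<epsilon> / (2 * (b - a + 1))"
    have \<eta>: "\<eta> > 0" "\<eta> * (b - a) < \<epsilon> / 2"
      using \<open>\<epsilon> > 0\<close> \<open>a \<le> b\<close> by (auto simp: \<eta>_def field_simps)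
    obtain \<delta> where "\<delta> > 0" and \<delta>: "\<And>P :: (real \<times> real) set.
       finite P \<and> (\<forall>(s, t)\<in>P. a \<le> s \<and> s < t \<and> t \<le> b) \<and>
       pairwise (\<lambda>p q. disjnt {fst p<..<snd p} {fst q<..<snd q}) P \<and>
       (\<Sum>(s, t)\<in>P. t - s) < \<delta> \<Longrightarrow> (\<Sum>(s, t)\<in>P. cmod (h t - h s)) < \<epsilon> / 2"
      using ac[unfolded abs_continuous_on_interval_def, rule_format, of "\<epsilon> / 2"] \<open>\<epsilon> > 0\<close>
      by auto
    have "N \<in> sets lebesgue" "N \<in> null_sets lebesgue"
      using \<open>negligible N\<close> by (auto simp: negligible_iff_null_sets)
    \<comment> \<open>Outer regularity: adding the null set \<open>N\<close> to the small remainder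
      \<open>U - N\<close> keeps the measure of \<open>U\<close> below
      \<open>\<delta>\<close>.\<close>
    then obtain U where U: "open U" "N \<subseteq> U" "U - N \<in> lmeasurable"
        "emeasure lebesgue (U - N) < ennreal \<delta>"
      using sets_lebesgue_outer_open[of N \<delta>] \<open>\<delta> > 0\<close> by blast
    have U_meas: "U \<in> lmeasurable" "measure lebesgue U < \<delta>"
    proof -
      have eq: "U = (U - N) \<union> N" using U(2) by blast
      show "U \<in> lmeasurable"
        by (subst eq) (rule fmeasurable.Un[OF U(3) negligible_imp_measurable[OF \<open>negligible N\<close>]])
      have "measure lebesgue U = measure lebesgue (U - N)"
        by (subst eq) (rule measure_Un_null_set, use U(3) \<open>N \<in> null_sets lebesgue\<close> in auto)
      then show "measure lebesgue U < \<delta>"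
        using U(3,4) \<open>\<delta> > 0\<close> by (simp add: emeasure_eq_measure2 ennreal_less_iff)
    qed
    have "\<forall>x. \<exists>d>0. x \<in> {a..b} - N \<longrightarrow>
         (\<forall>y\<in>{a..b}. norm (y-x) < d \<longrightarrow> norm (h y - h x - (y-x) *\<^sub>R h' x) \<le> \<eta> * norm (y-x))"
    proof
      fix x
      show "\<exists>d>0. x \<in> {a..b} - N \<longrightarrow>
         (\<forall>y\<in>{a..b}. norm (y-x) < d \<longrightarrow> norm (h y - h x - (y-x) *\<^sub>R h' x) \<le> \<eta> * norm (y-x))"
      proof (cases "x \<in> {a..b} - N")
        case True
        then show ?thesis
          using deriv[OF True, unfolded has_vector_derivative_def has_derivative_within_alt] \<eta>(1)
          by blast
      qed (auto intro: zero_less_one)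
    qed
    then obtain d where d: "\<And>x. 0 < d x"
        "\<And>x y. \<lbrakk>x \<in> {a..b} - N; y \<in> {a..b}; norm (y-x) < d x\<rbrakk>
          \<Longrightarrow> norm (h y - h x - (y-x) *\<^sub>R h' x) \<le> \<eta> * norm (y-x)"
      by metis
    txt \<open>Intervals tagged in \<open>N\<close> stay inside a set of measure less than \<open>\<delta>\<close>, where absolute continuity
      controls the increments of \<open>h\<close>; the others are controlled by the derivative.\<close>
    define \<gamma> where "\<gamma> = (\<lambda>x. if x \<in> N then U else ball x (d x))"
    have "gauge \<gamma>"
      using U d(1) by (auto simp: gauge_def \<gamma>_def)
    moreover have sums: "norm ((\<Sum>(x,K)\<in>p. measure lborel K *\<^sub>R k x) - (h b - h a)) < \<epsilon>"
      if p: "p tagged_division_of {a..b}" and fine: "\<gamma> fine p" for p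
    proof -
      note pD = tagged_division_ofD[OF p]
      have K: "K = {Inf K..Sup K}" "Inf K \<le> x" "x \<le> Sup K" "a \<le> Inf K" "Sup K \<le> b" "K \<subseteq> \<gamma> x"
          "measure lborel K = Sup K - Inf K"
        if "(x, K) \<in> p" for x K
      proof -
        obtain u v where uv: "K = {u..v}" using pD(4)[OF \<open>(x, K) \<in> p\<close>] by auto
        with pD(2,3)[OF \<open>(x, K) \<in> p\<close>] fine \<open>(x, K) \<in> p\<close>
        show "K = {Inf K..Sup K}" "Inf K \<le> x" "x \<le> Sup K" "a \<le> Inf K" "Sup K \<le> b" "K \<subseteq> \<gamma> x"
          "measure lborel K = Sup K - Inf K"
          by (auto simp: fine_def)
      qed
      define F where "F = (\<lambda>(x,K). measure lborel K *\<^sub>R k x - (h (Sup K) - h (Inf K)))"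
      \<comment> \<open>Degenerate intervals are left out: they contribute nothing, while the family
        in the definition of absolute continuity needs \<open>s < t\<close>, and several tags could
        share one point interval only if it had no interior.\<close>
      define bad where "bad = {(x,K)\<in>p. x \<in> N \<and> Inf K < Sup K}"
      have "finite p" "bad \<subseteq> p" by (auto simp: bad_def pD(1))
      have "finite bad" using \<open>finite p\<close> \<open>bad \<subseteq> p\<close> by (rule finite_subset[rotated])
      \<comment> \<open>Straddle estimate: the errors of the linear approximation at the tag
        \<open>x\<close>, taken at both ends \<open>u \<le> x \<le> v\<close>, differ by
        \<open>F z\<close>, and their bounds add up to \<open>\<eta> * (v - u)\<close>. A degenerate
        piece tagged in \<open>N\<close> gives 0.\<close>
      have good: "norm (F z) \<le> \<eta> * (\<lambda>(x,K). measure lborel K) z" if z_in: "z \<in> p - bad" for z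
      proof -
        obtain x K where z: "z = (x, K)" "(x, K) \<in> p"
          using z_in by (metis DiffD1 surj_pair)
        define u v where "u = Inf K" and "v = Sup K"
        note Kz = K[OF z(2), folded u_def v_def]
        show ?thesis
        proof (cases "x \<in> N")
          case True
          then have "u = v" using z_in z Kz(2,3) by (auto simp: bad_def u_def v_def)
          then show ?thesis using Kz(7) by (simp add: F_def z flip: u_def v_def)
        next
          case False
          have "u \<in> K" "v \<in> K"
            by (subst Kz(1), use Kz(2,3) in simp)+
          then have "norm (u - x) < d x" "norm (v - x) < d x"
            using Kz(6) False by (auto simp: \<gamma>_def dist_real_def)
          then have "norm (h u - h x - (u-x) *\<^sub>R h' x) \<le> \<eta> * norm (u-x)"
              "norm (h v - h x - (v-x) *\<^sub>R h' x) \<le> \<eta> * norm (v-x)"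
            using d(2)[of x u] d(2)[of x v] Kz(2-5) False by auto
          then have "norm (h u - h x - (u-x) *\<^sub>R h' x - (h v - h x - (v-x) *\<^sub>R h' x))
              \<le> \<eta> * norm (u-x) + \<eta> * norm (v-x)"
            by (meson add_mono norm_triangle_ineq4 order_trans)
          also have "\<dots> = \<eta> * (v - u)"
            using Kz(2,3) by (simp add: algebra_simps)
          also have "h u - h x - (u-x) *\<^sub>R h' x - (h v - h x - (v-x) *\<^sub>R h' x) = F z"
            using False Kz(7)
            by (simp add: F_def z k_def flip: u_def v_def) (simp add: scaleR_left_diff_distrib)
          finally show ?thesis using Kz(7) by (simp add: z)
        qed
      qed
      \<comment> \<open>Distinct pieces have disjoint interiors and bad pieces have nonempty ones,
        so a bad piece is determined by its endpoints. This allows sums over tagged pieces,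
        intervals and endpoint pairs to be exchanged.\<close>
      have inj: "inj_on (\<lambda>(x,K). (Inf K, Sup K)) bad" and inj': "inj_on snd bad"
        and disj: "(x,K) \<in> bad \<Longrightarrow> (y,L) \<in> bad \<Longrightarrow> (x,K) \<noteq> (y,L) \<Longrightarrow>
          {Inf K<..<Sup K} \<inter> {Inf L<..<Sup L} = {}" for x y K L
      proof -
        show dis: "{Inf K<..<Sup K} \<inter> {Inf L<..<Sup L} = {}"
          if "(x,K) \<in> bad" "(y,L) \<in> bad" "(x,K) \<noteq> (y,L)" for x y K L
        proof -
          have "interior K = {Inf K<..<Sup K}" "interior L = {Inf L<..<Sup L}"
            using K(1)[of x K] K(1)[of y L] that(1,2) \<open>bad \<subseteq> p\<close>
            by (metis interior_atLeastAtMost_real subsetD)+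
          then show ?thesis
            using pD(5)[of x K y L] that \<open>bad \<subseteq> p\<close> by auto
        qed
        show "inj_on (\<lambda>(x,K). (Inf K, Sup K)) bad"
        proof (rule inj_onI, clarify)
          fix x K y L assume *: "(x, K) \<in> bad" "(y, L) \<in> bad" "Inf K = Inf L" "Sup K = Sup L"
          then have "{Inf K<..<Sup K} \<noteq> {}" by (auto simp: bad_def)
          then show "x = y \<and> K = L" using dis[of x K y L] * by auto
        qed
        then show "inj_on snd bad"
          by (fastforce simp: inj_on_def)
      qed
      define P where "P = (\<lambda>(x,K). (Inf K, Sup K)) ` bad"
      have "(\<Sum>(s, t)\<in>P. cmod (h t - h s)) < \<epsilon> / 2"
      proof (rule \<delta>, intro conjI)
        show "finite P" using \<open>finite bad\<close> by (simp add: P_def)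
        show "\<forall>(s, t)\<in>P. a \<le> s \<and> s < t \<and> t \<le> b"
          using K(4,5) by (auto simp: P_def bad_def)
        show "pairwise (\<lambda>p q. disjnt {fst p<..<snd p} {fst q<..<snd q}) P"
        proof (rule pairwiseI)
          fix q r assume "q \<in> P" "r \<in> P" "q \<noteq> r"
          then obtain x K y L where "(x, K) \<in> bad" "(y, L) \<in> bad"
            and eq: "q = (Inf K, Sup K)" "r = (Inf L, Sup L)"
            unfolding P_def by auto
          then have "{Inf K<..<Sup K} \<inter> {Inf L<..<Sup L} = {}"
            using \<open>q \<noteq> r\<close> by (intro disj) auto
          then show "disjnt {fst q<..<snd q} {fst r<..<snd r}"
            unfolding disjnt_def eq fst_conv snd_conv .
        qed
        have part: "bad tagged_partial_division_of {a..b}"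
          using p \<open>bad \<subseteq> p\<close> tagged_partial_division_subset tagged_division_of_def by blast
        \<comment> \<open>The lengths add up to the measure of the union, and fineness puts every
          interval tagged in \<open>N\<close> inside \<open>U\<close>.\<close>
        have "(\<Sum>(s, t)\<in>P. t - s) = (\<Sum>(x,K)\<in>bad. measure lborel K)"
          unfolding P_def sum.reindex[OF inj] using K(7) \<open>bad \<subseteq> p\<close>
          by (intro sum.cong) auto
        also have "\<dots> = (\<Sum>K\<in>snd ` bad. measure lborel K)"
          by (simp add: sum.reindex[OF inj'] case_prod_unfold)
        also have "\<dots> = measure lebesgue (\<Union>(snd ` bad))"
        proof -
          have "measure lborel K = measure lebesgue K" if "K \<in> snd ` bad" for K
            using division_ofD(4)[OF partial_division_of_tagged_division[OF part] that] by auto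
          then show ?thesis
            using content_division[OF partial_division_of_tagged_division[OF part]] by simp
        qed
        also have "\<dots> \<le> measure lebesgue U"
        proof (rule measure_mono_fmeasurable)
          show "\<Union>(snd ` bad) \<subseteq> U"
          proof
            fix y assume "y \<in> \<Union>(snd ` bad)"
            then obtain x K where "(x, K) \<in> p" "x \<in> N" "y \<in> K" by (auto simp: bad_def)
            then show "y \<in> U" using K(6)[of x K] by (auto simp: \<gamma>_def)
          qed
          show "\<Union>(snd ` bad) \<in> sets lebesgue"
            using lmeasurable_division[OF partial_division_of_tagged_division[OF part]]
            by blast
        qed (use U_meas in auto)
        also have "\<dots> < \<delta>" using U_meas by blast
        finally show "(\<Sum>(s, t)\<in>P. t - s) < \<delta>" .
      qed
      also have "(\<Sum>(s, t)\<in>P. cmod (h t - h s)) = (\<Sum>z\<in>bad. norm (F z))"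
        unfolding P_def sum.reindex[OF inj]
        by (intro sum.cong) (auto simp: F_def k_def bad_def norm_minus_commute)
      finally have bad_sum: "(\<Sum>z\<in>bad. norm (F z)) < \<epsilon> / 2" .
      \<comment> \<open>The increments of \<open>h\<close> over the division telescope to
        \<open>h b - h a\<close>.\<close>
      have "(\<Sum>(x,K)\<in>p. measure lborel K *\<^sub>R k x) - (h b - h a) = (\<Sum>z\<in>p. F z)"
        using additive_tagged_division_1[OF \<open>a \<le> b\<close> p, of h]
        by (simp add: F_def case_prod_unfold sum_subtractf)
      also have "\<dots> = (\<Sum>z\<in>p - bad. F z) + (\<Sum>z\<in>bad. F z)"
        using sum.subset_diff[OF \<open>bad \<subseteq> p\<close> \<open>finite p\<close>] .
      also have "norm \<dots> \<le> (\<Sum>z\<in>p - bad. norm (F z)) + (\<Sum>z\<in>bad. norm (F z))"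
        by (intro norm_triangle_mono norm_sum)
      also have "(\<Sum>z\<in>p - bad. norm (F z)) \<le> (\<Sum>z\<in>p - bad. \<eta> * (\<lambda>(x,K). measure lborel K) z)"
        by (intro sum_mono good)
      also have "\<dots> \<le> (\<Sum>z\<in>p. \<eta> * (\<lambda>(x,K). measure lborel K) z)"
        using \<open>finite p\<close> \<eta>(1) by (intro sum_mono2) auto
      also have "\<dots> = \<eta> * (b - a)"
        using additive_content_tagged_division[of p a b] p \<open>a \<le> b\<close>
        unfolding sum_distrib_left[symmetric] by simp
      finally show ?thesis using bad_sum \<eta>(2) by simp
    qed
    ultimately show "\<exists>\<gamma>. gauge \<gamma> \<and> (\<forall>p. p tagged_division_of {a..b} \<and> \<gamma> fine p \<longrightarrow>
        norm ((\<Sum>(x,K)\<in>p. measure lborel K *\<^sub>R k x) - (h b - h a)) < \<epsilon>)"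
      by (intro exI[of _ \<gamma>] conjI allI impI sums) auto
  qed
  then show ?thesis
    by (rule has_integral_spike[OF \<open>negligible N\<close>, rotated]) (auto simp: k_def)
qed

section \<open>Absolute continuity: subintervals, Lipschitz functions, derivatives
  everywhere\<close>

lemma abs_continuous_on_interval_mono:
  assumes "abs_continuous_on_interval a b h" "a \<le> c" "d \<le> b"
  shows "abs_continuous_on_interval c d h"
  unfolding abs_continuous_on_interval_def
proof (intro allI impI)
  fix \<epsilon> :: real assume "\<epsilon> > 0"
  then obtain \<delta> where \<delta>: "\<delta> > 0" "\<And>P :: (real \<times> real) set.
       finite P \<and> (\<forall>(s, t)\<in>P. a \<le> s \<and> s < t \<and> t \<le> b) \<and>
       pairwise (\<lambda>p q. disjnt {fst p<..<snd p} {fst q<..<snd q}) P \<and>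
       (\<Sum>(s, t)\<in>P. t - s) < \<delta> \<Longrightarrow> (\<Sum>(s, t)\<in>P. cmod (h t - h s)) < \<epsilon>"
    using assms(1)[unfolded abs_continuous_on_interval_def, rule_format, of \<epsilon>] by auto
  show "\<exists>\<delta>>0. \<forall>P :: (real \<times> real) set.
       finite P \<and> (\<forall>(s, t)\<in>P. c \<le> s \<and> s < t \<and> t \<le> d) \<and>
       pairwise (\<lambda>p q. disjnt {fst p<..<snd p} {fst q<..<snd q}) P \<and>
       (\<Sum>(s, t)\<in>P. t - s) < \<delta> \<longrightarrow> (\<Sum>(s, t)\<in>P. cmod (h t - h s)) < \<epsilon>"
  proof (intro exI[of _ \<delta>] conjI allI impI \<delta>)
    fix P :: "(real \<times> real) set"
    assume "finite P \<and> (\<forall>(s, t)\<in>P. c \<le> s \<and> s < t \<and> t \<le> d) \<and>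
       pairwise (\<lambda>p q. disjnt {fst p<..<snd p} {fst q<..<snd q}) P \<and>
       (\<Sum>(s, t)\<in>P. t - s) < \<delta>"
    then show "finite P" "\<forall>(s, t)\<in>P. a \<le> s \<and> s < t \<and> t \<le> b"
      "pairwise (\<lambda>p q. disjnt {fst p<..<snd p} {fst q<..<snd q}) P"
      "(\<Sum>(s, t)\<in>P. t - s) < \<delta>"
      using assms(2,3) by fastforce+
  qed
qed

lemma lipschitz_imp_abs_continuous:
  assumes lip: "\<And>s t. a \<le> s \<Longrightarrow> s < t \<Longrightarrow> t \<le> b \<Longrightarrow> cmod (h t - h s) \<le> C * (t - s)" and "C > 0"
  shows "abs_continuous_on_interval a b h"
  unfolding abs_continuous_on_interval_def
proof (intro allI impI)
  fix \<epsilon> :: real assume "\<epsilon> > 0"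
  show "\<exists>\<delta>>0. \<forall>P :: (real \<times> real) set.
       finite P \<and> (\<forall>(s, t)\<in>P. a \<le> s \<and> s < t \<and> t \<le> b) \<and>
       pairwise (\<lambda>p q. disjnt {fst p<..<snd p} {fst q<..<snd q}) P \<and>
       (\<Sum>(s, t)\<in>P. t - s) < \<delta> \<longrightarrow> (\<Sum>(s, t)\<in>P. cmod (h t - h s)) < \<epsilon>"
  proof (intro exI[of _ "\<epsilon> / C"] conjI allI impI)
    fix P :: "(real \<times> real) set"
    assume P: "finite P \<and> (\<forall>(s, t)\<in>P. a \<le> s \<and> s < t \<and> t \<le> b) \<and>
       pairwise (\<lambda>p q. disjnt {fst p<..<snd p} {fst q<..<snd q}) P \<and>
       (\<Sum>(s, t)\<in>P. t - s) < \<epsilon> / C"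
    have "(\<Sum>(s, t)\<in>P. cmod (h t - h s)) \<le> (\<Sum>(s, t)\<in>P. C * (t - s))"
      using P lip by (intro sum_mono) auto
    also have "\<dots> = C * (\<Sum>(s, t)\<in>P. t - s)"
      by (simp add: sum_distrib_left case_prod_unfold)
    also have "\<dots> < \<epsilon>"
      using P \<open>C > 0\<close> by (simp add: field_simps)
    finally show "(\<Sum>(s, t)\<in>P. cmod (h t - h s)) < \<epsilon>" .
  qed (use \<open>\<epsilon> > 0\<close> \<open>C > 0\<close> in auto)
qed

text \<open>By the fundamental theorem on each \<open>{a..t}\<close>, \<open>h\<close> is
  \<open>h a\<close> plus the integral of the continuous \<open>\<phi>\<close>, and such an integral
  has derivative \<open>\<phi>\<close> at every point, one-sided at the ends.\<close>

lemma abs_continuous_has_vector_derivative: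
  assumes ac: "abs_continuous_on_interval a b h" and "continuous_on {a..b} \<phi>" and "negligible N"
    and deriv: "\<And>x. x \<in> {a..b} - N \<Longrightarrow> (h has_vector_derivative \<phi> x) (at x within {a..b})"
    and x: "x \<in> {a..b}"
  shows "(h has_vector_derivative \<phi> x) (at x within {a..b})"
proof -
  have eq: "h t = h a + integral {a..t} \<phi>" if "t \<in> {a..b}" for t
  proof -
    have "(\<phi> has_integral (h t - h a)) {a..t}"
    proof (rule abs_continuous_has_integral[OF _ _ \<open>negligible N\<close>])
      show "abs_continuous_on_interval a t h"
        using abs_continuous_on_interval_mono[OF ac] that by auto
      show "(h has_vector_derivative \<phi> x) (at x within {a..t})" if "x \<in> {a..t} - N" for x
        using has_vector_derivative_within_subset[OF deriv, of x "{a..t}"] that \<open>t \<in> {a..b}\<close> by auto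
    qed (use that in auto)
    then show ?thesis by (simp add: integral_unique)
  qed
  have "((\<lambda>t. h a + integral {a..t} \<phi>) has_vector_derivative \<phi> x) (at x within {a..b})"
    using integral_has_vector_derivative[OF assms(2) x]
    by (auto intro: derivative_eq_intros)
  then show ?thesis
    by (rule has_vector_derivative_transform[OF x, rotated]) (rule eq)
qed

section \<open>Sine waves on the edges\<close>

text \<open>Two conserved quantities of the harmonic oscillator take the place of a uniqueness
  theorem for the initial value problem.\<close>

lemma dirichlet_sine:
  fixes g h :: "real \<Rightarrow> complex"
  assumes dg: "\<And>x. x \<in> {0..1} \<Longrightarrow> (g has_vector_derivative h x) (at x within {0..1})"
    and dh: "\<And>x. x \<in> {0..1} \<Longrightarrow> (h has_vector_derivative - (k\<^sup>2 *\<^sub>R g x)) (at x within {0..1})"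
    and "g 0 = 0" and "k \<noteq> 0" and x: "x \<in> {0..1}"
  shows "g x = h 0 / complex_of_real k * complex_of_real (sin (k * x))"
proof -
  txt \<open>\<open>A\<close> and \<open>B\<close> are the coordinates of \<open>(h, k g)\<close> in a frame rotating with the flow of the
    equation, hence constant.\<close>
  define A where "A = (\<lambda>x. cos (k * x) *\<^sub>R h x + (k * sin (k * x)) *\<^sub>R g x)"
  define B where "B = (\<lambda>x. sin (k * x) *\<^sub>R h x - (k * cos (k * x)) *\<^sub>R g x)"
  have "(A has_vector_derivative 0) (at t within {0..1})" if "t \<in> {0..1}" for t
    unfolding A_def
    by (rule derivative_eq_intros refl dg[OF that] dh[OF that])+
      (simp add: algebra_simps power2_eq_square)
  then have "A x = A 0"
    using has_derivative_zero_constant[of "{0..1::real}" A] x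
    by (force simp: has_vector_derivative_def)
  moreover have "(B has_vector_derivative 0) (at t within {0..1})" if "t \<in> {0..1}" for t
    unfolding B_def
    by (rule derivative_eq_intros refl dg[OF that] dh[OF that])+
      (simp add: algebra_simps power2_eq_square)
  then have "B x = B 0"
    using has_derivative_zero_constant[of "{0..1::real}" B] x
    by (force simp: has_vector_derivative_def)
  \<comment> \<open>Rotating back cancels the terms in \<open>h\<close> and recovers
    \<open>k *\<^sub>R g x\<close>; at 0 the same constants are \<open>A 0 = h 0\<close> and
    \<open>B 0 = 0\<close>.\<close>
  moreover have "sin (k * x) *\<^sub>R A x - cos (k * x) *\<^sub>R B x =
      (k * (sin (k * x) * sin (k * x)) + k * (cos (k * x) * cos (k * x))) *\<^sub>R g x"
    by (simp add: A_def B_def algebra_simps)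
  moreover have "k * (sin (k * x) * sin (k * x)) + k * (cos (k * x) * cos (k * x)) = k"
    by (metis distrib_left mult.right_neutral power2_eq_square sin_cos_squared_add)
  ultimately have "k *\<^sub>R g x = sin (k * x) *\<^sub>R h 0"
    using \<open>g 0 = 0\<close> by (simp add: A_def B_def)
  then show ?thesis
    using \<open>k \<noteq> 0\<close> by (simp add: scaleR_conv_of_real field_simps)
qed

section \<open>Edge functions extended by zero\<close>

text \<open>Derivatives are taken within \<open>{0..1}\<close>, so the jump of the zero extension at
  the ends of an edge is not seen.\<close>

lemma edge_deriv_extend:
  assumes "\<And>e x. e \<in> E \<Longrightarrow> x \<in> {0..1} \<Longrightarrow> (w e has_vector_derivative w' e x) (at x within {0..1})"
  shows "edge_deriv E (\<lambda>e x. if e \<in> E \<and> x \<in> {0..1} then w e x else 0) =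
    (\<lambda>e x. if e \<in> E \<and> x \<in> {0..1} then w' e x else 0)"
proof (intro ext)
  fix e and x :: real
  show "edge_deriv E (\<lambda>e x. if e \<in> E \<and> x \<in> {0..1} then w e x else 0) e x =
    (if e \<in> E \<and> x \<in> {0..1} then w' e x else 0)"
  proof (cases "e \<in> E \<and> x \<in> {0..1}")
    case True
    then have "((\<lambda>x. if e \<in> E \<and> x \<in> {0..1} then w e x else 0) has_vector_derivative w' e x)
        (at x within {0..1})"
      by (intro has_vector_derivative_transform[OF _ _ assms[of e x]]) auto
    then show ?thesis
      using True vector_derivative_within_closed_interval[of 0 1 x] by (simp add: edge_deriv_def)
  qed (simp only: edge_deriv_def if_False)
qed

lemma continuous_imp_square_integrable:
  assumes "continuous_on {0..1} h"
  shows "square_integrable h"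
  unfolding square_integrable_def
proof
  show "h \<in> borel_measurable (lebesgue_on {0..1})"
    using assms by (intro continuous_imp_measurable_on_sets_lebesgue) auto
  show "integrable (lebesgue_on {0..1}) (\<lambda>x. (cmod (h x))\<^sup>2)"
    using assms by (intro continuous_imp_integrable_real continuous_intros)
qed

lemma L2_graph_extend:
  assumes "\<And>e. e \<in> E \<Longrightarrow> continuous_on {0..1} (w e)"
  shows "(\<lambda>e x. if e \<in> E \<and> x \<in> {0..1} then w e x else 0) \<in> L2_graph E"
proof -
  have "continuous_on {0..1} (\<lambda>x. if e \<in> E \<and> x \<in> {0..1} then w e x else 0)" if "e \<in> E" for e
    by (rule continuous_on_eq[OF assms[OF that]]) (use that in auto)
  then show ?thesis
    unfolding L2_graph_def on_graph_def by (auto intro: continuous_imp_square_integrable)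
qed

section \<open>Derivatives and vertex conditions of the sine waves\<close>

definition freq :: "nat \<Rightarrow> real" where
  "freq n = (2 * real n - 1) * pi"

text \<open>Since \<open>freq n\<close> is an odd multiple of \<open>\<pi>\<close>, the outward derivatives of the sine wave at the two
  ends of an edge agree; hence the derivative condition does not depend on the orientation.\<close>

lemma sin_freq: "sin (freq n) = 0" and cos_freq: "cos (freq n) = - 1"
proof -
  have "freq n = 2 * real n * pi - pi" by (simp add: freq_def algebra_simps)
  then show "sin (freq n) = 0" "cos (freq n) = - 1" by (simp_all add: sin_diff cos_diff)
qed

lemma freq_pos: "n \<ge> 1 \<Longrightarrow> freq n > 0"
  by (simp add: freq_def)

lemma sine_map_freq:
  "sine_map E n f = (\<lambda>e x. if e \<in> E \<and> x \<in> {0..1} then f e * complex_of_real (sin (freq n * x)) else 0)"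
  unfolding sine_map_def freq_def by (rule refl)

lemma edge_deriv_sine_map:
  "edge_deriv E (sine_map E n f) =
    (\<lambda>e x. if e \<in> E \<and> x \<in> {0..1} then f e * complex_of_real (freq n * cos (freq n * x)) else 0)"
  unfolding sine_map_freq
  by (rule edge_deriv_extend)
    (auto intro!: derivative_eq_intros has_vector_derivative_of_real simp: algebra_simps)

lemma edge_deriv2_sine_map:
  "edge_deriv E (edge_deriv E (sine_map E n f)) =
    (\<lambda>e x. if e \<in> E \<and> x \<in> {0..1}
      then - (f e * complex_of_real ((freq n)\<^sup>2 * sin (freq n * x))) else 0)"
  unfolding edge_deriv_sine_map
  by (rule edge_deriv_extend)
    (auto intro!: derivative_eq_intros has_vector_derivative_of_real simp: algebra_simps power2_eq_square)

lemma vertex_value_sine_map: "vertex_value org (sine_map E n f) e v = 0"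
  by (simp add: vertex_value_def sine_map_freq sin_freq)

lemma normal_deriv_sine_map:
  "e \<in> E \<Longrightarrow> normal_deriv E org (sine_map E n f) e v = complex_of_real (freq n) * f e"
  by (simp add: normal_deriv_def edge_deriv_sine_map cos_freq)

text \<open>Continuity is automatic, as all vertex values are 0, and the derivative condition is the
  equation of \<open>Z1\<close> times the nonzero \<open>freq n\<close>. One direction yields
  eigenfunctions, the other recovers membership in \<open>Z1\<close>.\<close>

lemma standard_vertex_conditions_sine_map:
  assumes "n \<ge> 1"
  shows "standard_vertex_conditions V E org (sine_map E n f) \<longleftrightarrow>
    (\<forall>v\<in>V. (\<Sum>e\<in>incident_edges E v. f e) = 0)"
proof -
  have "(\<Sum>e\<in>incident_edges E v. normal_deriv E org (sine_map E n f) e v) =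
      complex_of_real (freq n) * (\<Sum>e\<in>incident_edges E v. f e)" for v
    unfolding sum_distrib_left
    by (intro sum.cong) (auto simp: incident_edges_def normal_deriv_sine_map)
  then show ?thesis
    using freq_pos[OF assms] by (simp add: standard_vertex_conditions_def vertex_value_sine_map)
qed

lemma abs_continuous_edge_deriv_sine_map:
  assumes "e \<in> E"
  shows "abs_continuous_on_interval 0 1 (edge_deriv E (sine_map E n f) e)"
proof (rule lipschitz_imp_abs_continuous)
  fix s t :: real assume st: "0 \<le> s" "s < t" "t \<le> 1"
  have "\<bar>cos (freq n * t) - cos (freq n * s)\<bar> \<le> \<bar>freq n\<bar> * \<bar>t - s\<bar>"
  proof -
    have "norm (cos (freq n * t) - cos (freq n * s)) \<le> \<bar>freq n\<bar> * norm (t - s)"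
    proof (rule field_differentiable_bound[of UNIV])
      show "((\<lambda>t. cos (freq n * t)) has_field_derivative - (freq n * sin (freq n * z))) (at z)" for z
        by (auto intro!: derivative_eq_intros)
      show "norm (- (freq n * sin (freq n * z))) \<le> \<bar>freq n\<bar>" for z
        using mult_left_mono[OF abs_sin_le_one[of "freq n * z"], of "\<bar>freq n\<bar>"]
        by (simp add: abs_mult)
    qed auto
    then show ?thesis by simp
  qed
  then have "cmod (f e) * \<bar>freq n\<bar> * \<bar>cos (freq n * t) - cos (freq n * s)\<bar>
      \<le> cmod (f e) * \<bar>freq n\<bar> * (\<bar>freq n\<bar> * \<bar>t - s\<bar>)"
    by (intro mult_left_mono) auto
  moreover have "edge_deriv E (sine_map E n f) e t - edge_deriv E (sine_map E n f) e s =
      f e * complex_of_real (freq n * (cos (freq n * t) - cos (freq n * s)))"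
    using st assms by (simp add: edge_deriv_sine_map algebra_simps)
  ultimately have "cmod (edge_deriv E (sine_map E n f) e t - edge_deriv E (sine_map E n f) e s)
      \<le> cmod (f e) * (freq n)\<^sup>2 * (t - s)"
    using st by (simp only: norm_mult norm_of_real) (simp add: abs_mult power2_eq_square mult_ac)
  \<comment> \<open>The \<open>+ 1\<close> makes the Lipschitz constant positive even when
    \<open>f e = 0\<close>.\<close>
  also have "\<dots> \<le> (cmod (f e) * (freq n)\<^sup>2 + 1) * (t - s)"
    using st by (intro mult_right_mono) auto
  finally show "cmod (edge_deriv E (sine_map E n f) e t - edge_deriv E (sine_map E n f) e s)
      \<le> (cmod (f e) * (freq n)\<^sup>2 + 1) * (t - s)" .
qed (simp add: add_nonneg_pos)

section \<open>Sine waves with coefficients in \<open>Z1\<close> are eigenfunctions\<close>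

lemma sine_map_eigenfunction:
  assumes "n \<ge> 1" and f: "f \<in> Z1 V E"
  shows "sine_map E n f \<in> eigenspace0 V E org (complex_of_real ((freq n)\<^sup>2))"
proof -
  let ?g = "sine_map E n f"
  \<comment> \<open>\<open>edge_deriv\<close> names a value whether or not a derivative exists, so
    the differentiability required by the domain is proved separately from the formulas for that
    value.\<close>
  have dg: "(?g e has_vector_derivative edge_deriv E ?g e x) (at x within {0..1})"
    and ddg: "(edge_deriv E ?g e has_vector_derivative edge_deriv E (edge_deriv E ?g) e x) (at x within {0..1})"
    if "e \<in> E" "x \<in> {0..1}" for e x
  proof -
    have 1: "((\<lambda>x. f e * complex_of_real (sin (freq n * x))) has_vector_derivative
        f e * complex_of_real (freq n * cos (freq n * x))) (at x within {0..1})"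
      by (auto intro!: derivative_eq_intros has_vector_derivative_of_real simp: algebra_simps)
    have "edge_deriv E ?g e x = f e * complex_of_real (freq n * cos (freq n * x))"
      using that by (simp add: edge_deriv_sine_map)
    then show "(?g e has_vector_derivative edge_deriv E ?g e x) (at x within {0..1})"
      by (simp only:) (rule has_vector_derivative_transform[OF that(2) _ 1],
        use that in \<open>simp add: sine_map_freq\<close>)
    have 2: "((\<lambda>x. f e * complex_of_real (freq n * cos (freq n * x))) has_vector_derivative
        - (f e * complex_of_real ((freq n)\<^sup>2 * sin (freq n * x)))) (at x within {0..1})"
      by (auto intro!: derivative_eq_intros has_vector_derivative_of_real
          simp: algebra_simps power2_eq_square)
    have "edge_deriv E (edge_deriv E ?g) e x = - (f e * complex_of_real ((freq n)\<^sup>2 * sin (freq n * x)))"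
      using that by (simp add: edge_deriv2_sine_map)
    then show "(edge_deriv E ?g e has_vector_derivative edge_deriv E (edge_deriv E ?g) e x)
        (at x within {0..1})"
      by (simp only:) (rule has_vector_derivative_transform[OF that(2) _ 2],
        use that in \<open>simp add: edge_deriv_sine_map\<close>)
  qed
  have "?g \<in> L2_graph E" "edge_deriv E (edge_deriv E ?g) \<in> L2_graph E"
    unfolding edge_deriv2_sine_map unfolding sine_map_freq
    by (intro L2_graph_extend continuous_intros)+
  moreover have "?g e differentiable_on {0..1}"
      "AE x in lebesgue_on {0..1}. edge_deriv E ?g e differentiable (at x within {0..1})"
    if "e \<in> E" for e
    using differentiableI_vector[OF dg[OF that]] differentiableI_vector[OF ddg[OF that]]
    by (auto simp: differentiable_on_def intro!: AE_I2)
  moreover have "standard_vertex_conditions V E org ?g"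
    using f unfolding standard_vertex_conditions_sine_map[OF \<open>n \<ge> 1\<close>] Z1_def by simp
  ultimately have "?g \<in> laplacian_domain V E org"
    using abs_continuous_edge_deriv_sine_map by (auto simp: laplacian_domain_def)
  moreover have "laplacian E ?g e x = complex_of_real ((freq n)\<^sup>2) * ?g e x" for e x
    unfolding laplacian_def edge_deriv2_sine_map unfolding sine_map_freq by simp
  ultimately show ?thesis
    by (simp add: eigenspace0_def eigenspace_def vertex_value_sine_map)
qed

section \<open>Eigenfunctions vanishing at the vertices are sine waves\<close>

lemma eigenfunction_eq_sine:
  assumes g: "g \<in> eigenspace V E org (complex_of_real (k\<^sup>2))" and "k \<noteq> 0" "e \<in> E" "g e 0 = 0"
    and "x \<in> {0..1}"
  shows "g e x = edge_deriv E g e 0 / complex_of_real k * complex_of_real (sin (k * x))"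
proof (rule dirichlet_sine)
  let ?h = "edge_deriv E g e"
  have diff: "g e differentiable_on {0..1}" and ac: "abs_continuous_on_interval 0 1 ?h"
    and ae1: "AE x in lebesgue_on {0..1}. ?h differentiable (at x within {0..1})"
    and ae2: "AE x in lebesgue_on {0..1}. laplacian E g e x = complex_of_real (k\<^sup>2) * g e x"
    using g \<open>e \<in> E\<close> by (auto simp: eigenspace_def laplacian_domain_def)
  show "(g e has_vector_derivative ?h x) (at x within {0..1})" if "x \<in> {0..1}" for x
    using diff that \<open>e \<in> E\<close>
    by (simp add: edge_deriv_def differentiable_on_def flip: vector_derivative_works)
  \<comment> \<open>Differentiability of \<open>?h\<close> and the eigenvalue equation are merged so
    that a single null set \<open>N\<close> carries both exceptions.\<close>
  have "AE x in lebesgue. x \<in> {0..1} \<longrightarrow>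
      ?h differentiable (at x within {0..1}) \<and> laplacian E g e x = complex_of_real (k\<^sup>2) * g e x"
    using ae1 ae2 by (subst (asm) (1 2) AE_restrict_space_iff) auto
  then obtain N where N: "N \<in> null_sets lebesgue" "\<And>x. x \<in> {0..1} - N \<Longrightarrow>
      ?h differentiable (at x within {0..1}) \<and> laplacian E g e x = complex_of_real (k\<^sup>2) * g e x"
    unfolding eventually_ae_filter by auto
  \<comment> \<open>The right-hand side is continuous because \<open>g e\<close> is differentiable,
    so the equation extends from almost every point to all of \<open>{0..1}\<close>.\<close>
  show "(?h has_vector_derivative - (k\<^sup>2 *\<^sub>R g e x)) (at x within {0..1})" if "x \<in> {0..1}" for x
  proof (rule abs_continuous_has_vector_derivative[OF ac _ _ _ that])
    show "continuous_on {0..1} (\<lambda>x. - (k\<^sup>2 *\<^sub>R g e x))"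
      using differentiable_imp_continuous_on[OF diff] by (intro continuous_intros)
    show "negligible N" using N(1) by (simp add: negligible_iff_null_sets)
    show "(?h has_vector_derivative - (k\<^sup>2 *\<^sub>R g e x)) (at x within {0..1})"
      if "x \<in> {0..1} - N" for x
    proof -
      have "- vector_derivative ?h (at x within {0..1}) = k\<^sup>2 *\<^sub>R g e x"
        using N(2)[OF that] that \<open>e \<in> E\<close>
        by (simp add: laplacian_def edge_deriv_def[of E "edge_deriv E g"] scaleR_conv_of_real)
      then have "vector_derivative ?h (at x within {0..1}) = - (k\<^sup>2 *\<^sub>R g e x)"
        by (metis minus_minus)
      then show ?thesis
        using N(2)[OF that] by (metis vector_derivative_works)
    qed
  qed
qed (use assms in auto)

lemma eigenspace0_eq_sine_map_image:
  assumes "simple_graph V E" "orientation E org" "n \<ge> 1"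
  shows "eigenspace0 V E org (complex_of_real ((freq n)\<^sup>2)) = sine_map E n ` Z1 V E"
proof (intro equalityI subsetI)
  fix g assume g: "g \<in> eigenspace0 V E org (complex_of_real ((freq n)\<^sup>2))"
  then have eig: "g \<in> eigenspace V E org (complex_of_real ((freq n)\<^sup>2))"
    by (simp add: eigenspace0_def)
  then have "on_graph E g" and svc: "standard_vertex_conditions V E org g"
    by (auto simp: eigenspace_def laplacian_domain_def L2_graph_def)
  \<comment> \<open>A wave \<open>c * sin (freq n * x)\<close> has slope \<open>c * freq n\<close>
    at 0, which dictates the coefficient; off \<open>E\<close> it must be 0 for
    \<open>Z1\<close>.\<close>
  define f where "f = (\<lambda>e. if e \<in> E then edge_deriv E g e 0 / complex_of_real (freq n) else 0)"
  have "g e 0 = 0" if "e \<in> E" for e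
  proof -
    have "org e \<in> V" "e \<in> incident_edges E (org e)"
      using assms(1,2) that by (auto simp: simple_graph_def orientation_def incident_edges_def)
    then have "vertex_value org g e (org e) = 0"
      using g by (auto simp: eigenspace0_def)
    then show ?thesis by (simp add: vertex_value_def)
  qed
  then have g_eq: "g = sine_map E n f"
    using eigenfunction_eq_sine[OF eig] freq_pos[OF \<open>n \<ge> 1\<close>] \<open>on_graph E g\<close>
    by (auto simp: fun_eq_iff sine_map_freq f_def on_graph_def)
  have "\<forall>e. e \<notin> E \<longrightarrow> f e = 0" by (simp add: f_def)
  then have "f \<in> Z1 V E"
    using svc unfolding g_eq standard_vertex_conditions_sine_map[OF \<open>n \<ge> 1\<close>]
    by (simp add: Z1_def)
  then show "g \<in> sine_map E n ` Z1 V E" using g_eq by blast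
qed (use sine_map_eigenfunction[OF \<open>n \<ge> 1\<close>] in blast)

section \<open>Linearity, injectivity and the isomorphism\<close>

lemma linear_sine_map: "Vector_Spaces.linear edge_scale graph_scale (sine_map E n)"
  unfolding Vector_Spaces.linear_iff
  using edge_fun.vector_space_axioms graph_fun.vector_space_axioms
  by (auto simp: sine_map_def edge_scale_def graph_scale_def fun_eq_iff algebra_simps)

lemma subspace_Z1: "edge_fun.subspace (Z1 V E)"
  by (auto simp: edge_fun.subspace_def Z1_def edge_scale_def sum.distrib simp flip: sum_distrib_left)

lemma inj_on_sine_map:
  assumes "n \<ge> 1"
  shows "inj_on (sine_map E n) (Z1 V E)"
proof (rule inj_onI, rule ext)
  fix f f' e assume ff': "f \<in> Z1 V E" "f' \<in> Z1 V E" "sine_map E n f = sine_map E n f'"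
  \<comment> \<open>At this point the sine reaches 1, so evaluation there reads off the coefficient;
    \<open>n \<ge> 1\<close> places it in \<open>{0..1}\<close>.\<close>
  define x where "x = 1 / (2 * (2 * real n - 1))"
  have x: "x \<in> {0..1}" "freq n * x = pi / 2"
    using assms by (auto simp: x_def freq_def field_simps)
  have sin_x: "sin (freq n * x) = 1" by (simp only: x(2) sin_pi_half)
  show "f e = f' e"
  proof (cases "e \<in> E")
    case True
    then show ?thesis
      using fun_cong[OF fun_cong[OF ff'(3)], of e x] x(1) sin_x by (simp add: sine_map_freq)
  qed (use ff' in \<open>simp add: Z1_def\<close>)
qed

theorem theorem2p9:
  fixes V :: "'v set" and E :: "'v set set" and org :: "'v set \<Rightarrow> 'v" and n :: nat
  assumes "simple_graph V E"
    and "\<forall>v\<in>V. vertex_degree E v \<ge> 2"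
    and "orientation E org"
    and "n \<ge> 1"
  shows "edge_fun.subspace (Z1 V E) \<and>
    graph_fun.subspace (eigenspace0 V E org (complex_of_real ((2 * real n - 1)\<^sup>2 * pi\<^sup>2))) \<and>
    Vector_Spaces.linear edge_scale graph_scale (sine_map E n) \<and>
    bij_betw (sine_map E n) (Z1 V E)
      (eigenspace0 V E org (complex_of_real ((2 * real n - 1)\<^sup>2 * pi\<^sup>2))) \<and>
    (\<exists>B. edge_fun.independent B \<and> edge_fun.span B = Z1 V E \<and> (\<forall>f\<in>B. \<forall>e. f e \<in> \<int>))"
proof -
  have freq: "(2 * real n - 1)\<^sup>2 * pi\<^sup>2 = (freq n)\<^sup>2"
    by (simp add: freq_def power_mult_distrib)
  have "finite V" "finite E"
    using assms(1) finite_subset[of E "Pow V"] by (auto simp: simple_graph_def)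
  note image = eigenspace0_eq_sine_map_image[OF assms(1,3,4)]
  interpret S: Vector_Spaces.linear edge_scale graph_scale "sine_map E n"
    by (rule linear_sine_map)
  \<comment> \<open>Once the eigenspace is rewritten as the image of \<open>Z1\<close>, it is a
    subspace by linearity, and bijectivity reduces to injectivity.\<close>
  show ?thesis
    unfolding freq image
    using subspace_Z1 S.subspace_image[OF subspace_Z1] linear_sine_map
      inj_on_imp_bij_betw[OF inj_on_sine_map[OF assms(4)]]
      Z1_integer_basis[OF \<open>finite V\<close> \<open>finite E\<close>]
    by blast
qed

end
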